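(* Let $(A,D)$ be an inclusion. For every $n\in N(A,D)$ and every $d\in D$, \[n^*nd=dn^*n\in D\quad\text{and}\quad nn^*d=dnn^*\in D.\] Furthermore, if $n\in N(A,D)$ and $\rho_1$ and $\rho_2$ are states on $A$ such that $\rho_1|_D=\rho_2|_D\in\hat D$, then $\rho_1(n^*n)=\rho_2(n^*n)$ and $\rho_1(nn^* )=\rho_2(nn^* )$.
   Context: An inclusion is a pair $(A,D)$ where $A$ and $D$ are $C^*$-algebras (not assumed unital), $D$ is abelian, and $D\subseteq A$ is a $C^*$-subalgebra. The set of normalizers of an inclusion $(A,D)$ is $N(A,D):=\{n\in A: nDn^*\cup n^*Dn\subseteq D\}$. $\hat D$ denotes the set of pure states (equivalently, nonzero multiplicative linear functionals) of the abelian $C^*$-algebra $D$. *)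

theory Defs
  imports "HOL-Analysis.Analysis" "HOL-Library.Complex_Order"
begin

(* real_normed_algebra does not include a unit, so C*-algebras are not assumed
   to be unital.  The real scalar multiplication of the type is the restriction
   of the complex one. *)
class cstar_algebra = real_normed_algebra + banach +
  fixes scaleC :: "complex \<Rightarrow> 'a \<Rightarrow> 'a"  (infixr "*\<^sub>C" 75)
    and adj :: "'a \<Rightarrow> 'a"  ("_\<^sup>\<star>" [1000] 999)
  assumes scaleC_add_right: "c *\<^sub>C (x + y) = c *\<^sub>C x + c *\<^sub>C y"
    and scaleC_add_left: "(c + d) *\<^sub>C x = c *\<^sub>C x + d *\<^sub>C x"
    and scaleC_scaleC: "c *\<^sub>C d *\<^sub>C x = (c * d) *\<^sub>C x"
    and scaleR_scaleC: "r *\<^sub>R x = complex_of_real r *\<^sub>C x"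
    and mult_scaleC_left: "(c *\<^sub>C x) * y = c *\<^sub>C (x * y)"
    and mult_scaleC_right: "x * (c *\<^sub>C y) = c *\<^sub>C (x * y)"
    and norm_scaleC: "norm (c *\<^sub>C x) = cmod c * norm x"
    and adj_add: "(x + y)\<^sup>\<star> = x\<^sup>\<star> + y\<^sup>\<star>"
    and adj_scaleC: "(c *\<^sub>C x)\<^sup>\<star> = cnj c *\<^sub>C x\<^sup>\<star>"
    and adj_mult: "(x * y)\<^sup>\<star> = y\<^sup>\<star> * x\<^sup>\<star>"
    and adj_adj: "(x\<^sup>\<star>)\<^sup>\<star> = x"
    and norm_adj_mult: "norm (x\<^sup>\<star> * x) = (norm x)\<^sup>2"

definition cstar_subalgebra :: "'a::cstar_algebra set \<Rightarrow> bool" where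
  "cstar_subalgebra B \<longleftrightarrow>
     0 \<in> B \<and> (\<forall>x\<in>B. \<forall>y\<in>B. x + y \<in> B) \<and> (\<forall>c. \<forall>x\<in>B. c *\<^sub>C x \<in> B) \<and>
     (\<forall>x\<in>B. \<forall>y\<in>B. x * y \<in> B) \<and> (\<forall>x\<in>B. x\<^sup>\<star> \<in> B) \<and> closed B"

(* The inclusion (A, D), where A is the whole type. *)
definition inclusion :: "'a::cstar_algebra set \<Rightarrow> bool" where
  "inclusion D \<longleftrightarrow> cstar_subalgebra D \<and> (\<forall>x\<in>D. \<forall>y\<in>D. x * y = y * x)"

definition normalizers :: "'a::cstar_algebra set \<Rightarrow> 'a set" where
  "normalizers D = {n. (\<lambda>d. n * d * n\<^sup>\<star>) ` D \<union> (\<lambda>d. n\<^sup>\<star> * d * n) ` D \<subseteq> D}"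

(* In the following, B is a C*-subalgebra (possibly UNIV), and only the values
   of a functional on B matter. *)

(* The order on the complex numbers is that of Complex_Order: 0 \<le> z means that
   z is real and nonnegative. *)
definition positive_functional_on :: "'a::cstar_algebra set \<Rightarrow> ('a \<Rightarrow> complex) \<Rightarrow> bool" where
  "positive_functional_on B \<phi> \<longleftrightarrow>
     (\<forall>x\<in>B. \<forall>y\<in>B. \<phi> (x + y) = \<phi> x + \<phi> y) \<and>
     (\<forall>c. \<forall>x\<in>B. \<phi> (c *\<^sub>C x) = c * \<phi> x) \<and>
     (\<forall>x\<in>B. 0 \<le> \<phi> (x\<^sup>\<star> * x))"

(* The supremum of an unbounded set of reals is a junk value, so boundedness is
   stated separately. *)
definition state_on :: "'a::cstar_algebra set \<Rightarrow> ('a \<Rightarrow> complex) \<Rightarrow> bool" where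
  "state_on B \<phi> \<longleftrightarrow> positive_functional_on B \<phi> \<and>
     bdd_above ((\<lambda>x. cmod (\<phi> x)) ` {x\<in>B. norm x \<le> 1}) \<and>
     (SUP x\<in>{x\<in>B. norm x \<le> 1}. cmod (\<phi> x)) = 1"

definition pure_state_on :: "'a::cstar_algebra set \<Rightarrow> ('a \<Rightarrow> complex) \<Rightarrow> bool" where
  "pure_state_on B \<phi> \<longleftrightarrow> state_on B \<phi> \<and>
     (\<forall>\<psi>. positive_functional_on B \<psi> \<and> positive_functional_on B (\<lambda>x. \<phi> x - \<psi> x) \<longrightarrow>
        (\<exists>t::real. 0 \<le> t \<and> t \<le> 1 \<and> (\<forall>x\<in>B. \<psi> x = complex_of_real t * \<phi> x)))"

(* Functionals on D are represented by functions that are undefined outside D. *)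
definition pure_states :: "'a::cstar_algebra set \<Rightarrow> ('a \<Rightarrow> complex) set" where
  "pure_states D = {\<phi> \<in> extensional D. pure_state_on D \<phi>}"

end

theory Submission
  imports Defs
begin

text \<open>
  Everything rests on contractive local units: for a selfadjoint \<open>h\<close> in the abelian
  algebra \<open>D\<close> and \<open>e > 0\<close> there is a selfadjoint contraction \<open>u\<close> in \<open>D\<close>, a multiple of \<open>h\<close>,
  with \<open>u h\<close> within \<open>e\<close> of \<open>h\<close>. Formally \<open>u = s h\<^sup>2 (1 + s h\<^sup>2)\<^sup>-\<^sup>1\<close> for a large \<open>s\<close>. It is
  obtained as a fixed point of a Banach contraction, and its norm estimates come from the
  inequality \<open>\<parallel>p\<parallel>\<^sup>2 \<le> \<parallel>p\<^sup>2 + q\<^sup>2\<parallel>\<close> for commuting selfadjoint \<open>p\<close>, \<open>q\<close>,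
  which is the C*-identity for \<open>p + i q\<close>.

  A consequence (\<open>in_D_if_squares_in_D\<close>) is that \<open>y\<close> lies in \<open>D\<close> as soon as \<open>y y*\<close> and
  \<open>y y* y\<close> do, because \<open>u y\<close> tends to \<open>y\<close> for local units \<open>u\<close> of \<open>y y*\<close>. Let \<open>a = n* n\<close> for a
  normalizer \<open>n\<close>. Applied to \<open>y = d a e\<close>, this criterion gives \<open>D a D \<subseteq> D\<close>, since in \<open>y y*\<close> and
  \<open>y y* y\<close> every \<open>n\<close> and \<open>n*\<close> can be grouped into blocks \<open>n D n*\<close> and \<open>n* D n\<close>. Applied then to
  \<open>y = a e\<close> it gives \<open>a D \<subseteq> D\<close>. The commutator \<open>T = e a - a e\<close> is now an element of \<open>D\<close> with
  \<open>T e = e T = 0\<close>, so that \<open>T\<^sup>2 = 0\<close> and hence \<open>T = 0\<close>.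

  For the second part, a pure state \<open>\<sigma>\<close> of \<open>D\<close> is shown to be multiplicative. Choose \<open>e\<close> in \<open>D\<close>
  with \<open>\<sigma>(e) = 1\<close>. A state \<open>\<phi>\<close> of the whole algebra that extends \<open>\<sigma>\<close> satisfies
  \<open>\<phi>(a) = \<sigma>(a e)\<close>, a number that depends on \<open>\<sigma>\<close> only (\<open>extension_determined\<close>). Indeed
  \<open>k\<^sub>0 = a - a e\<close> satisfies \<open>D k\<^sub>0 \<subseteq> ker \<sigma>\<close>, so it can be replaced by \<open>k = (1 - u) k\<^sub>0\<close> without
  changing its value under \<open>\<phi>\<close>. Let \<open>d\<close> be a selfadjoint contraction of \<open>D\<close> with \<open>\<sigma>(d)\<close> close
  to \<open>1\<close>. If \<open>u\<close> is a local unit for \<open>d\<close>, then \<open>d k\<close> is small, so \<open>d + c k\<close> has norm at most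
  \<open>1 + O(|c|\<^sup>2)\<close> up to the approximation error, while \<open>\<phi>\<close> takes a value close to
  \<open>1 + c \<phi>(k\<^sub>0)\<close> there. Since \<open>\<phi>\<close> has norm one, \<open>\<phi>(k\<^sub>0) = 0\<close>.
\<close>

section \<open>Preliminaries\<close>

lemma scaleC_one [simp]: "1 *\<^sub>C (x::'a::cstar_algebra) = x"
  using scaleR_scaleC[of 1 x] by simp

lemma scaleC_minus_one: "(-1) *\<^sub>C (x::'a::cstar_algebra) = - x"
  using scaleR_scaleC[of "-1" x] by simp

lemma scaleC_minus_left: "(- c) *\<^sub>C (x::'a::cstar_algebra) = - (c *\<^sub>C x)"
  using scaleC_scaleC[of "-1" c x] by (simp add: scaleC_minus_one)

lemma scaleC_diff_right: "c *\<^sub>C ((x::'a::cstar_algebra) - y) = c *\<^sub>C x - c *\<^sub>C y"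
  by (metis add_diff_cancel_right' diff_add_cancel scaleC_add_right)

lemma adj_scaleR: "(r *\<^sub>R (x::'a::cstar_algebra))\<^sup>\<star> = r *\<^sub>R x\<^sup>\<star>"
  by (simp add: scaleR_scaleC adj_scaleC)

lemma adj_minus: "(- (x::'a::cstar_algebra))\<^sup>\<star> = - x\<^sup>\<star>"
  using adj_scaleR[of "-1" x] by simp

lemma adj_diff: "((x::'a::cstar_algebra) - y)\<^sup>\<star> = x\<^sup>\<star> - y\<^sup>\<star>"
  using adj_add[of x "-y"] by (simp add: adj_minus)

lemma norm_adj: "norm ((x::'a::cstar_algebra)\<^sup>\<star>) = norm x"
proof -
  have le: "norm z \<le> norm (z\<^sup>\<star>)" for z :: 'a
  proof (cases "norm z = 0")
    case False
    have "(norm z)\<^sup>2 \<le> norm (z\<^sup>\<star>) * norm z"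
      unfolding norm_adj_mult[symmetric] by (rule norm_mult_ineq)
    with False show ?thesis by (simp add: power2_eq_square)
  qed auto
  from le[of x] le[of "x\<^sup>\<star>"] show ?thesis by (simp add: adj_adj)
qed

lemma norm_mult_adj: "norm ((x::'a::cstar_algebra) * x\<^sup>\<star>) = (norm x)\<^sup>2"
  using norm_adj_mult[of "x\<^sup>\<star>"] by (simp add: adj_adj norm_adj)

lemma norm_bound_state:
  fixes x :: "'a::cstar_algebra"
  assumes \<phi>: "state_on B \<phi>" and B: "\<And>c x. x \<in> B \<Longrightarrow> c *\<^sub>C x \<in> B" and x: "x \<in> B"
  shows "cmod (\<phi> x) \<le> norm x"
proof (cases "x = 0")
  case True
  have "\<phi> (0 *\<^sub>C x) = 0 * \<phi> x"
    using \<phi> x by (auto simp: state_on_def positive_functional_on_def)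
  then show ?thesis
    using True scaleR_scaleC[of 0 x] by simp
next
  case False
  define y where "y = complex_of_real (1 / norm x) *\<^sub>C x"
  have "norm y = 1" "y \<in> B"
    using False by (simp_all add: y_def norm_scaleC B x norm_divide)
  then have "cmod (\<phi> y) \<le> (SUP x\<in>{x\<in>B. norm x \<le> 1}. cmod (\<phi> x))"
    using \<phi> by (intro cSUP_upper) (auto simp: state_on_def)
  also have "\<dots> = 1" using \<phi> by (simp add: state_on_def)
  finally have "cmod (\<phi> y) \<le> 1" .
  moreover have "\<phi> y = complex_of_real (1 / norm x) * \<phi> x"
    using \<phi> x unfolding y_def state_on_def positive_functional_on_def by blast
  ultimately show ?thesis
    using False by (simp add: norm_divide field_simps)
qed

lemma normalizer_conj:
  fixes n :: "'a::cstar_algebra"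
  assumes "n \<in> normalizers D" "d \<in> D"
  shows "n * d * n\<^sup>\<star> \<in> D" "n\<^sup>\<star> * d * n \<in> D"
  using assms by (auto simp: normalizers_def)

lemma adj_normalizer: "(n::'a::cstar_algebra) \<in> normalizers D \<Longrightarrow> n\<^sup>\<star> \<in> normalizers D"
  by (auto simp: normalizers_def adj_adj)

text \<open>
  This replaces the order on positive elements: with \<open>w = p + i q\<close> the right-hand side is
  \<open>\<parallel>w* w\<parallel> = \<parallel>w\<parallel>\<^sup>2\<close>, and \<open>p\<close> is the mean of \<open>w\<close> and \<open>w*\<close>.
\<close>
lemma norm_le_norm_sum_squares:
  fixes p q :: "'a::cstar_algebra"
  assumes sa: "p\<^sup>\<star> = p" "q\<^sup>\<star> = q" and comm: "p * q = q * p"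
  shows "(norm p)\<^sup>2 \<le> norm (p * p + q * q)"
proof -
  define w where "w = p + \<i> *\<^sub>C q"
  have adj_w: "w\<^sup>\<star> = p - \<i> *\<^sub>C q"
    using scaleC_scaleC[of "-1" \<i> q]
    by (simp add: w_def adj_add adj_scaleC sa scaleC_minus_one)
  have "w\<^sup>\<star> * w = p * p + q * q"
    using scaleC_scaleC[of \<i> \<i> "q * q"]
    by (simp add: adj_w) (simp add: w_def algebra_simps mult_scaleC_left mult_scaleC_right comm
        scaleC_minus_one scaleC_diff_right)
  then have w: "(norm w)\<^sup>2 = norm (p * p + q * q)"
    by (metis norm_adj_mult)
  have "2 *\<^sub>R p = w + w\<^sup>\<star>"
    unfolding adj_w by (simp add: w_def scaleR_2)
  then have "2 * norm p \<le> norm w + norm (w\<^sup>\<star>)"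
    by (metis norm_triangle_ineq norm_scaleR abs_numeral)
  then have "norm p \<le> norm w" by (simp add: norm_adj)
  then show ?thesis unfolding w[symmetric] by (simp add: power_mono)
qed

section \<open>Contractive local units\<close>

definition selfadjoint_part :: "'a::cstar_algebra set \<Rightarrow> 'a set" where
  "selfadjoint_part D = {x\<in>D. x\<^sup>\<star> = x}"

context
  fixes D :: "'a::cstar_algebra set"
  assumes D: "inclusion D"
begin

lemma D_add: "x \<in> D \<Longrightarrow> y \<in> D \<Longrightarrow> x + y \<in> D"
  and D_scaleC: "x \<in> D \<Longrightarrow> c *\<^sub>C x \<in> D"
  and D_mult: "x \<in> D \<Longrightarrow> y \<in> D \<Longrightarrow> x * y \<in> D"
  and D_adj: "x \<in> D \<Longrightarrow> x\<^sup>\<star> \<in> D"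
  and D_closed: "closed D"
  and D_comm: "x \<in> D \<Longrightarrow> y \<in> D \<Longrightarrow> x * y = y * x"
  and D_zero: "0 \<in> D"
  using D by (auto simp: inclusion_def cstar_subalgebra_def)

lemma D_scaleR: "x \<in> D \<Longrightarrow> r *\<^sub>R x \<in> D"
  by (simp add: scaleR_scaleC D_scaleC)

lemma D_diff: "x \<in> D \<Longrightarrow> y \<in> D \<Longrightarrow> x - y \<in> D"
  using D_add[of x "- y"] D_scaleC[of y "-1"] by (simp add: scaleC_minus_one)

lemma D_left_comm: "x \<in> D \<Longrightarrow> y \<in> D \<Longrightarrow> x * (y * z) = y * (x * z)"
  by (metis D_comm mult.assoc)

lemmas D_intros = D_add D_scaleC D_mult D_adj D_zero D_scaleR D_diff

lemma D_limit:
  assumes "\<And>e. e > 0 \<Longrightarrow> \<exists>d\<in>D. norm (x - d) \<le> e"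
  shows "x \<in> D"
proof -
  have "\<exists>d\<in>D. dist d x < e" if "e > 0" for e
    using assms[of "e/2"] that by (force simp: dist_norm norm_minus_commute)
  then show ?thesis
    using D_closed by (metis closed_approachable)
qed

lemma sa_add: "x \<in> selfadjoint_part D \<Longrightarrow> y \<in> selfadjoint_part D \<Longrightarrow> x + y \<in> selfadjoint_part D"
  and sa_diff: "x \<in> selfadjoint_part D \<Longrightarrow> y \<in> selfadjoint_part D \<Longrightarrow> x - y \<in> selfadjoint_part D"
  and sa_mult: "x \<in> selfadjoint_part D \<Longrightarrow> y \<in> selfadjoint_part D \<Longrightarrow> x * y \<in> selfadjoint_part D"
  and sa_scaleR: "x \<in> selfadjoint_part D \<Longrightarrow> r *\<^sub>R x \<in> selfadjoint_part D"
  and sa_in: "x \<in> selfadjoint_part D \<Longrightarrow> x \<in> D"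
  and sa_adj: "x \<in> selfadjoint_part D \<Longrightarrow> x\<^sup>\<star> = x"
  using D_comm by (auto simp: selfadjoint_part_def adj_add adj_diff adj_mult adj_scaleR D_intros)

lemmas sa_intros = sa_add sa_diff sa_mult sa_scaleR

lemma norm_le_norm_sum_squares_sa:
  "p \<in> selfadjoint_part D \<Longrightarrow> q \<in> selfadjoint_part D \<Longrightarrow> (norm p)\<^sup>2 \<le> norm (p * p + q * q)"
  by (intro norm_le_norm_sum_squares sa_adj D_comm sa_in)

lemma complete_sa: "complete (selfadjoint_part D)"
proof -
  have "bounded_linear (adj :: 'a \<Rightarrow> 'a)"
    by (rule bounded_linear_intro[where K = 1]) (simp_all add: adj_add adj_scaleR norm_adj)
  then have "closed {x::'a. x\<^sup>\<star> = x}"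
    by (intro closed_Collect_eq) (auto intro: linear_continuous_on)
  then have "closed (D \<inter> {x. x\<^sup>\<star> = x})"
    using D_closed by blast
  then show ?thesis
    by (simp add: complete_eq_closed selfadjoint_part_def Collect_conj_eq)
qed

text \<open>
  Formally \<open>u = x\<^sup>2 (1 + x\<^sup>2)\<^sup>-\<^sup>1\<close>. With \<open>b = x\<^sup>2\<close>, the equation \<open>u + b u = b\<close> says that \<open>u\<close> is a
  fixed point of \<open>v \<mapsto> (b + (m - b) v) / (1 + m)\<close>. This map contracts for large \<open>m\<close>, since \<open>b\<close> is
  a square: the term linear in \<open>b\<close> of \<open>(m - b)\<^sup>2 = m\<^sup>2 - 2 m x\<^sup>2 + b\<^sup>2\<close> can be cancelled by adding
  the square of a multiple of \<open>x\<close>. Multiplication by \<open>m - b\<close> thus has norm at most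
  \<open>sqrt (m\<^sup>2 + \<parallel>b\<parallel>\<^sup>2)\<close>, which is less than \<open>1 + m\<close> when \<open>m = \<parallel>b\<parallel>\<^sup>2\<close>.
\<close>
lemma ex_quasi_resolvent:
  assumes x: "x \<in> selfadjoint_part D"
  shows "\<exists>u\<in>selfadjoint_part D. u + x * x * u = x * x"
proof -
  define b where "b = x * x"
  define m where "m = (norm b)\<^sup>2"
  define c where "c = sqrt (m\<^sup>2 + m) / (1 + m)"
  define F where "F v = (1 / (1 + m)) *\<^sub>R (b + m *\<^sub>R v - b * v)" for v
  have m: "m \<ge> 0" by (simp add: m_def)
  have b: "b \<in> selfadjoint_part D" unfolding b_def by (intro sa_intros x)
  have est: "norm (m *\<^sub>R z - b * z) \<le> sqrt (m\<^sup>2 + m) * norm z"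
    if z: "z \<in> selfadjoint_part D" for z
  proof -
    define p where "p = m *\<^sub>R z - b * z"
    \<comment> \<open>The square of \<open>q\<close> cancels the mixed term of \<open>p\<^sup>2\<close>.\<close>
    define q where "q = sqrt (2 * m) *\<^sub>R (x * z)"
    have xz: "z * x = x * z" "\<And>w. z * (x * w) = x * (z * w)"
      using D_comm D_left_comm sa_in x z by auto
    have "p * p + q * q = m\<^sup>2 *\<^sub>R (z * z) + (b * z) * (b * z)"
      using m by (simp add: p_def q_def b_def algebra_simps xz power2_eq_square real_sqrt_mult_self
          flip: scaleR_add_left)
    then have "(norm p)\<^sup>2 \<le> norm (m\<^sup>2 *\<^sub>R (z * z) + (b * z) * (b * z))"
      using norm_le_norm_sum_squares_sa[of p q] by (simp add: p_def q_def sa_intros x z b)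
    also have "\<dots> \<le> m\<^sup>2 * (norm z * norm z) + (norm b * norm z) * (norm b * norm z)"
      by (intro norm_triangle_le add_mono)
         (auto intro!: mult_left_mono norm_mult_ineq order_trans[OF norm_mult_ineq] mult_mono)
    also have "\<dots> = (sqrt (m\<^sup>2 + m) * norm z)\<^sup>2"
      using m by (simp add: power_mult_distrib) (simp add: m_def power2_eq_square algebra_simps)
    finally show ?thesis
      unfolding p_def by (rule power2_le_imp_le) (use m in simp)
  qed
  have "\<exists>!u\<in>selfadjoint_part D. F u = u"
  proof (rule Banach_fix[where c = c])
    have "m\<^sup>2 + m < (1 + m)\<^sup>2" using m by (simp add: power2_eq_square algebra_simps)
    then have "sqrt (m\<^sup>2 + m) < 1 + m" using m by (simp add: real_less_lsqrt)
    then show "0 \<le> c" "c < 1" using m by (simp_all add: c_def)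
    show "F ` selfadjoint_part D \<subseteq> selfadjoint_part D"
      unfolding F_def using b by (auto intro!: sa_intros)
    show "\<And>v w. v \<in> selfadjoint_part D \<Longrightarrow> w \<in> selfadjoint_part D \<Longrightarrow> dist (F v) (F w) \<le> c * dist v w"
    proof -
      fix v w assume vw: "v \<in> selfadjoint_part D" "w \<in> selfadjoint_part D"
      have "F v - F w = (1 / (1 + m)) *\<^sub>R (m *\<^sub>R (v - w) - b * (v - w))"
        by (simp add: F_def algebra_simps)
      then have "norm (F v - F w) = (1 / (1 + m)) * norm (m *\<^sub>R (v - w) - b * (v - w))"
        using m by simp
      also have "\<dots> \<le> (1 / (1 + m)) * (sqrt (m\<^sup>2 + m) * norm (v - w))"
        using m vw by (intro mult_left_mono est sa_intros) auto
      finally show "dist (F v) (F w) \<le> c * dist v w"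
        by (simp add: c_def dist_norm)
    qed
  qed (use complete_sa b in auto)
  then obtain u where u: "u \<in> selfadjoint_part D" "F u = u" by blast
  have "(1 + m) *\<^sub>R F u = b + m *\<^sub>R u - b * u"
    using m by (simp add: F_def)
  then have "u + b * u = b"
    unfolding u(2) by (simp add: algebra_simps)
  with u(1) show ?thesis unfolding b_def by auto
qed

text \<open>
  Rescale \<open>x = h / e\<close>, take \<open>u = x\<^sup>2 (1 + x\<^sup>2)\<^sup>-\<^sup>1\<close> and \<open>t = x - u x = x (1 + x\<^sup>2)\<^sup>-\<^sup>1\<close>. The identity
  \<open>u\<^sup>2 + t\<^sup>2 = u\<close> bounds both norms by \<open>1\<close>, and \<open>h - u h = e t\<close>. The factorization \<open>u = f h\<close> is
  recorded because \<open>h y \<in> D\<close> then gives \<open>u y \<in> D\<close>, also for \<open>y\<close> outside \<open>D\<close>.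
\<close>
lemma local_unit:
  assumes h: "h \<in> selfadjoint_part D" and e: "e > 0"
  obtains u f where "u \<in> selfadjoint_part D" "f \<in> D" "u = f * h" "norm u \<le> 1" "norm (h - u * h) \<le> e"
proof -
  define x where "x = (1 / e) *\<^sub>R h"
  have x: "x \<in> selfadjoint_part D" unfolding x_def by (intro sa_intros h)
  obtain u where u: "u \<in> selfadjoint_part D" and eq: "u + x * x * u = x * x"
    using ex_quasi_resolvent[OF x] by blast
  define t where "t = x - u * x"
  have t: "t \<in> selfadjoint_part D" unfolding t_def by (intro sa_intros x u)
  have xu: "x * u = u * x" using D_comm sa_in x u by auto
  have u_eq: "u = t * x"
    using eq by (simp add: t_def algebra_simps xu)
       (metis add_diff_cancel_right' mult.assoc xu)
  have "t * t = t * x - (t * x) * u"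
    by (simp add: t_def algebra_simps xu)
  then have sum: "u * u + t * t = u"
    unfolding u_eq[symmetric] by simp
  have "(norm u)\<^sup>2 \<le> norm u"
    using norm_le_norm_sum_squares_sa[OF u t] by (simp add: sum)
  then have nu: "norm u \<le> 1"
    by (cases "norm u = 0") (simp_all add: power2_eq_square)
  have "(norm t)\<^sup>2 \<le> norm u"
    using norm_le_norm_sum_squares_sa[OF t u] unfolding add.commute[of "t * t"] sum .
  then have nt: "norm t \<le> 1"
    using nu power2_le_imp_le[of "norm t" 1] by simp
  have "h - u * h = e *\<^sub>R t"
    using e by (simp add: t_def x_def algebra_simps)
  then have "norm (h - u * h) \<le> e"
    using nt e by simp
  moreover have "u = ((1 / e) *\<^sub>R t) * h"
    using u_eq by (simp add: x_def)
  ultimately show ?thesis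
    using that[of u "(1 / e) *\<^sub>R t"] u nu t by (auto intro: D_intros sa_in)
qed

text \<open>
  If \<open>u\<close> is a local unit for \<open>h = y y*\<close>, then \<open>(y - u y) (y - u y)* = (h - u h) - (h - u h) u\<close>
  is small, and \<open>u y\<close> is a multiple of \<open>h y \<in> D\<close>. Thus \<open>y\<close> is a limit of elements of \<open>D\<close>.
\<close>
lemma in_D_if_squares_in_D:
  assumes h: "y * y\<^sup>\<star> \<in> D" and hy: "y * y\<^sup>\<star> * y \<in> D"
  shows "y \<in> D"
proof (rule D_limit)
  fix e :: real assume e: "e > 0"
  define h where "h = y * y\<^sup>\<star>"
  have h_sa: "h \<in> selfadjoint_part D"
    using h by (simp add: h_def selfadjoint_part_def adj_mult adj_adj)
  obtain u f where u: "u \<in> selfadjoint_part D" and f: "f \<in> D" "u = f * h" and nu: "norm u \<le> 1"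
    and nh: "norm (h - u * h) \<le> e\<^sup>2 / 2"
    using local_unit[OF h_sa, of "e\<^sup>2 / 2"] e by auto
  have "u * y \<in> D"
    using f hy by (simp add: h_def D_mult mult.assoc)
  moreover have "norm (y - u * y) \<le> e"
  proof -
    have "(y - u * y) * (y - u * y)\<^sup>\<star> = (h - u * h) - (h - u * h) * u"
      by (simp add: adj_diff adj_mult sa_adj[OF u] h_def algebra_simps)
    then have "(norm (y - u * y))\<^sup>2 = norm ((h - u * h) - (h - u * h) * u)"
      by (metis norm_mult_adj)
    also have "\<dots> \<le> norm (h - u * h) + norm (h - u * h) * norm u"
      by (intro order_trans[OF norm_triangle_ineq4] add_mono norm_mult_ineq order_refl)
    also have "\<dots> \<le> e\<^sup>2 / 2 + e\<^sup>2 / 2 * 1"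
      using nh nu by (intro add_mono mult_mono) auto
    finally have "(norm (y - u * y))\<^sup>2 \<le> e\<^sup>2" by simp
    then show ?thesis
      by (rule power2_le_imp_le) (use e in simp)
  qed
  ultimately show "\<exists>d\<in>D. norm (y - d) \<le> e" by blast
qed

section \<open>Normalizers\<close>

text \<open>
  For \<open>y = d n* n e\<close>, both \<open>y y*\<close> and \<open>y y* y\<close> can be bracketed so that only conjugates of
  elements of \<open>D\<close> by \<open>n\<close> and \<open>n*\<close> occur.
\<close>
lemma normalizer_two_sided:
  assumes n: "n \<in> normalizers D" and d: "d \<in> D" and e: "e \<in> D"
  shows "d * (n\<^sup>\<star> * n) * e \<in> D"
proof (rule in_D_if_squares_in_D)
  define y where "y = d * (n\<^sup>\<star> * n) * e"
  define g where "g = n * (e * e\<^sup>\<star>) * n\<^sup>\<star>"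
  have g: "g \<in> D" unfolding g_def by (intro normalizer_conj n D_intros e)
  have k: "n * (d\<^sup>\<star> * d) * n\<^sup>\<star> \<in> D" by (intro normalizer_conj n D_intros d)
  have "y * y\<^sup>\<star> = d * (n\<^sup>\<star> * g * n) * d\<^sup>\<star>"
    by (simp add: y_def g_def adj_mult adj_adj mult.assoc)
  then show "y * y\<^sup>\<star> \<in> D"
    by (simp add: D_intros normalizer_conj n d g)
  have "y * y\<^sup>\<star> * y = d * (n\<^sup>\<star> * (g * (n * (d\<^sup>\<star> * d) * n\<^sup>\<star>)) * n) * e"
    by (simp add: y_def g_def adj_mult adj_adj mult.assoc)
  then show "y * y\<^sup>\<star> * y \<in> D"
    by (simp add: D_mult normalizer_conj(2) n d e g k)
qed

text \<open>
  For \<open>y = n* n e\<close> the bracketing works for \<open>y y*\<close> but leaves \<open>y y* y = (y y*) (n* n) e\<close> with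
  an unmatched factor \<open>n* n\<close>. As \<open>y y* \<in> D\<close>, this product falls under the two-sided case.
\<close>
lemma normalizer_one_sided:
  assumes n: "n \<in> normalizers D" and e: "e \<in> D"
  shows "n\<^sup>\<star> * n * e \<in> D"
proof (rule in_D_if_squares_in_D)
  define y where "y = n\<^sup>\<star> * n * e"
  have "y * y\<^sup>\<star> = n\<^sup>\<star> * (n * (e * e\<^sup>\<star>) * n\<^sup>\<star>) * n"
    by (simp add: y_def adj_mult adj_adj mult.assoc)
  then show yy: "y * y\<^sup>\<star> \<in> D"
    by (simp add: D_intros normalizer_conj n e)
  have "(y * y\<^sup>\<star>) * (n\<^sup>\<star> * n) * e \<in> D"
    by (rule normalizer_two_sided[OF n yy e])
  then show "y * y\<^sup>\<star> * y \<in> D"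
    by (simp add: y_def mult.assoc)
qed

lemma normalizer_commute:
  assumes n: "n \<in> normalizers D" and e: "e \<in> D"
  shows "n\<^sup>\<star> * n * e = e * (n\<^sup>\<star> * n)" "e * (n\<^sup>\<star> * n) \<in> D"
proof -
  define a where "a = n\<^sup>\<star> * n"
  have ae: "a * e \<in> D"
    using normalizer_one_sided[OF n e] by (simp add: a_def)
  have "(a * e\<^sup>\<star>)\<^sup>\<star> \<in> D"
    using normalizer_one_sided[OF n D_adj[OF e]] by (simp add: a_def D_adj)
  then have ea: "e * a \<in> D"
    by (simp add: a_def adj_mult adj_adj)
  define T where "T = e * a - a * e"
  have TD: "T \<in> D" unfolding T_def by (intro D_intros ea ae)
  \<comment> \<open>Since \<open>e a\<close> and \<open>a e\<close> commute with \<open>e\<close>, both \<open>e\<^sup>2 a\<close> and \<open>a e\<^sup>2\<close> equal \<open>e a e\<close>.\<close>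
  have "e * T = 0"
    using D_comm[OF e ea] by (simp add: T_def algebra_simps)
  moreover from this have "T * e = 0"
    using D_comm[OF e TD] by simp
  moreover have "T * T = (T * e) * a - (a * e) * T"
    using D_comm[OF TD ae] by (simp add: T_def algebra_simps)
  ultimately have "T * T = 0"
    by (simp add: mult.assoc)
  \<comment> \<open>\<open>T\<close> is normal, being an element of the abelian algebra \<open>D\<close>, so nilpotency forces \<open>T = 0\<close>.\<close>
  then have "T\<^sup>\<star> * T * (T\<^sup>\<star> * T) = 0"
    using D_left_comm[OF TD D_adj[OF TD], of T] by (simp add: mult.assoc)
  then have "norm ((T\<^sup>\<star> * T)\<^sup>\<star> * (T\<^sup>\<star> * T)) = 0"
    by (simp add: adj_mult adj_adj)
  then have "T = 0"
    by (simp add: norm_adj_mult)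
  then have "a * e = e * a"
    unfolding T_def by (metis eq_iff_diff_eq_0)
  then show "n\<^sup>\<star> * n * e = e * (n\<^sup>\<star> * n)" "e * (n\<^sup>\<star> * n) \<in> D"
    using ea unfolding a_def by blast+
qed


section \<open>Pure states of an abelian algebra\<close>

lemma sa_decomposition:
  assumes "z \<in> D"
  obtains p q where "p \<in> selfadjoint_part D" "q \<in> selfadjoint_part D" "z = p + \<i> *\<^sub>C q"
proof (rule that)
  let ?p = "(1/2) *\<^sub>C (z + z\<^sup>\<star>)" and ?q = "(- \<i> / 2) *\<^sub>C (z - z\<^sup>\<star>)"
  show "?p \<in> selfadjoint_part D" "?q \<in> selfadjoint_part D"
    using assms by (simp_all add: selfadjoint_part_def D_intros adj_scaleC adj_add adj_diff adj_adj
        add.commute scaleC_diff_right scaleC_minus_left)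
  show "z = ?p + \<i> *\<^sub>C ?q"
    by (simp add: scaleC_scaleC flip: scaleC_add_right scaleC_add_left)
       (simp add: scaleC_add_right flip: scaleC_add_left)
qed

context
  fixes \<sigma> :: "'a \<Rightarrow> complex"
  assumes pure: "pure_state_on D \<sigma>"
begin

lemma state: "state_on D \<sigma>"
  using pure by (simp add: pure_state_on_def)

lemma \<sigma>_add: "x \<in> D \<Longrightarrow> y \<in> D \<Longrightarrow> \<sigma> (x + y) = \<sigma> x + \<sigma> y"
  and \<sigma>_scaleC: "x \<in> D \<Longrightarrow> \<sigma> (c *\<^sub>C x) = c * \<sigma> x"
  and \<sigma>_pos: "x \<in> D \<Longrightarrow> 0 \<le> \<sigma> (x\<^sup>\<star> * x)"
  using state by (auto simp: state_on_def positive_functional_on_def)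

lemma \<sigma>_scaleR: "x \<in> D \<Longrightarrow> \<sigma> (r *\<^sub>R x) = complex_of_real r * \<sigma> x"
  by (simp add: scaleR_scaleC \<sigma>_scaleC)

lemma \<sigma>_diff: "x \<in> D \<Longrightarrow> y \<in> D \<Longrightarrow> \<sigma> (x - y) = \<sigma> x - \<sigma> y"
  using \<sigma>_add[of "x - y" y] by (simp add: D_diff)

lemma \<sigma>_bound: "x \<in> D \<Longrightarrow> cmod (\<sigma> x) \<le> norm x"
  by (rule norm_bound_state[OF state]) (rule D_scaleC)

lemma \<sigma>_norming:
  assumes "r < 1"
  obtains x where "x \<in> D" "norm x \<le> 1" "r < cmod (\<sigma> x)"
proof -
  have "r < (SUP x\<in>{x\<in>D. norm x \<le> 1}. cmod (\<sigma> x))"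
    using assms state by (simp add: state_on_def)
  then have "\<exists>x\<in>{x\<in>D. norm x \<le> 1}. r < cmod (\<sigma> x)"
    by (subst (asm) less_cSUP_iff) (use state D_zero in \<open>auto simp: state_on_def intro!: exI[of _ 0]\<close>)
  with that show ?thesis by blast
qed

text \<open>
  This stands in for \<open>d* d \<le> 1\<close>. Let \<open>q(d) = \<sigma>((d x)* (d x))\<close>, let \<open>S\<close> be its supremum over the
  contractions \<open>d\<close> in \<open>D\<close>, and put \<open>c = d* d\<close>. Positivity of \<open>\<sigma>\<close> at \<open>x - c x\<close> gives
  \<open>2 q(d) \<le> \<sigma>(x* x) + q(c) \<le> \<sigma>(x* x) + S\<close>. Taking the supremum over \<open>d\<close> gives
  \<open>S \<le> \<sigma>(x* x)\<close>.
\<close>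
lemma \<sigma>_contraction_le:
  assumes x: "x \<in> D" and d: "d \<in> D" "norm d \<le> 1"
  shows "Re (\<sigma> ((d * x)\<^sup>\<star> * (d * x))) \<le> Re (\<sigma> (x\<^sup>\<star> * x))"
proof -
  define q where "q d = Re (\<sigma> ((d * x)\<^sup>\<star> * (d * x)))" for d
  define B where "B = {d\<in>D. norm d \<le> 1}"
  define S where "S = Sup (q ` B)"
  have bdd: "bdd_above (q ` B)"
  proof (rule bdd_aboveI2)
    fix d assume d: "d \<in> B"
    then have "norm (d * x) \<le> norm x"
      using norm_mult_ineq[of d x] mult_right_mono[of "norm d" 1 "norm x"] by (simp add: B_def)
    then have "norm ((d * x)\<^sup>\<star> * (d * x)) \<le> (norm x)\<^sup>2"
      unfolding norm_adj_mult by (simp add: power_mono)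
    moreover have "q d \<le> norm ((d * x)\<^sup>\<star> * (d * x))"
      unfolding q_def using d x
      by (intro order_trans[OF complex_Re_le_cmod] \<sigma>_bound) (auto simp: B_def D_intros)
    ultimately show "q d \<le> (norm x)\<^sup>2" by linarith
  qed
  have step: "q d \<le> (Re (\<sigma> (x\<^sup>\<star> * x)) + S) / 2" if d: "d \<in> B" for d
  proof -
    define c where "c = d\<^sup>\<star> * d"
    have dD: "d \<in> D" and c: "c \<in> D" "c\<^sup>\<star> = c"
      using d by (auto simp: B_def c_def D_intros adj_mult adj_adj)
    have "norm c \<le> 1"
      using d by (simp add: c_def norm_adj_mult B_def power_le_one)
    then have "q c \<le> S"
      unfolding S_def using c by (intro cSUP_upper bdd) (auto simp: B_def)
    have "(x - c * x)\<^sup>\<star> * (x - c * x) =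
        x\<^sup>\<star> * x - ((d * x)\<^sup>\<star> * (d * x) + (d * x)\<^sup>\<star> * (d * x)) + (c * x)\<^sup>\<star> * (c * x)"
      by (simp add: adj_diff adj_mult c(2) algebra_simps) (simp add: c_def mult.assoc)
    then have "\<sigma> ((x - c * x)\<^sup>\<star> * (x - c * x)) = \<sigma> (x\<^sup>\<star> * x)
        - (\<sigma> ((d * x)\<^sup>\<star> * (d * x)) + \<sigma> ((d * x)\<^sup>\<star> * (d * x))) + \<sigma> ((c * x)\<^sup>\<star> * (c * x))"
      by (simp add: \<sigma>_add \<sigma>_diff D_intros x dD c)
    moreover have "0 \<le> \<sigma> ((x - c * x)\<^sup>\<star> * (x - c * x))"
      by (intro \<sigma>_pos D_intros x c)
    ultimately have "0 \<le> Re (\<sigma> (x\<^sup>\<star> * x)) - 2 * q d + q c"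
      by (simp add: less_eq_complex_def q_def)
    with \<open>q c \<le> S\<close> have "2 * q d \<le> Re (\<sigma> (x\<^sup>\<star> * x)) + S"
      by argo
    then show ?thesis by simp
  qed
  have "d \<in> B" using d by (simp add: B_def)
  then have "S \<le> (Re (\<sigma> (x\<^sup>\<star> * x)) + S) / 2"
    unfolding S_def[of] by (intro cSUP_least) (use step S_def in auto)
  moreover have "q d \<le> S"
    unfolding S_def by (intro cSUP_upper bdd \<open>d \<in> B\<close>)
  ultimately show ?thesis by (simp add: q_def)
qed

text \<open>
  The functional \<open>x \<mapsto> \<sigma>(z x)\<close> is a multiple of \<open>\<sigma>\<close>. In the cross-multiplied form this condition
  is linear in \<open>z\<close> and passes to limits.
\<close>
definition mult_proportional :: "'a \<Rightarrow> bool" where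
  "mult_proportional z \<longleftrightarrow> (\<forall>x\<in>D. \<forall>y\<in>D. \<sigma> (z * x) * \<sigma> y = \<sigma> (z * y) * \<sigma> x)"

text \<open>
  This is where purity is used: \<open>x \<mapsto> \<sigma>(d* d x)\<close> is a positive functional dominated by \<open>\<sigma>\<close>.
\<close>
lemma mult_proportional_adj_mult:
  assumes d: "d \<in> D" "norm d \<le> 1"
  shows "mult_proportional (d\<^sup>\<star> * d)"
proof -
  define \<psi> where "\<psi> z = \<sigma> (d\<^sup>\<star> * d * z)" for z
  have dd: "d\<^sup>\<star> * d \<in> D" by (intro D_intros d)
  have \<psi>_sq: "\<psi> (x\<^sup>\<star> * x) = \<sigma> ((d * x)\<^sup>\<star> * (d * x))" if "x \<in> D" for x
    using D_left_comm[OF dd D_adj[OF that], of x] by (simp add: \<psi>_def adj_mult mult.assoc)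
  have "positive_functional_on D \<psi>"
    unfolding positive_functional_on_def
  proof (intro conjI ballI allI)
    fix x y assume "x \<in> D" "y \<in> D"
    then show "\<psi> (x + y) = \<psi> x + \<psi> y"
      by (simp add: \<psi>_def distrib_left \<sigma>_add D_mult dd)
  next
    fix c x assume "x \<in> D"
    then show "\<psi> (c *\<^sub>C x) = c * \<psi> x"
      by (simp add: \<psi>_def mult_scaleC_right \<sigma>_scaleC D_mult dd)
  next
    fix x assume "x \<in> D"
    then show "0 \<le> \<psi> (x\<^sup>\<star> * x)"
      by (simp add: \<psi>_sq \<sigma>_pos D_mult d)
  qed
  moreover from this have "positive_functional_on D (\<lambda>x. \<sigma> x - \<psi> x)"
    unfolding positive_functional_on_def
  proof (intro conjI ballI allI)
    fix x assume x: "x \<in> D"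
    have "0 \<le> \<sigma> (x\<^sup>\<star> * x)" "0 \<le> \<sigma> ((d * x)\<^sup>\<star> * (d * x))"
      by (intro \<sigma>_pos D_intros x d)+
    then show "0 \<le> \<sigma> (x\<^sup>\<star> * x) - \<psi> (x\<^sup>\<star> * x)"
      using \<sigma>_contraction_le[OF x d] by (simp add: less_eq_complex_def \<psi>_sq x)
  qed (simp_all add: \<sigma>_add \<sigma>_scaleC algebra_simps)
  ultimately obtain t :: real where "\<forall>x\<in>D. \<psi> x = complex_of_real t * \<sigma> x"
    using pure unfolding pure_state_on_def by blast
  then show ?thesis
    by (simp add: mult_proportional_def \<psi>_def)
qed

lemma mult_proportional_add:
  assumes "mult_proportional z" "mult_proportional w" "z \<in> D" "w \<in> D"
  shows "mult_proportional (z + w)"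
  using assms by (simp add: mult_proportional_def distrib_right \<sigma>_add D_intros)

lemma mult_proportional_scaleC:
  assumes "mult_proportional z" "z \<in> D"
  shows "mult_proportional (c *\<^sub>C z)"
  using assms by (simp add: mult_proportional_def mult_scaleC_left \<sigma>_scaleC D_intros)

lemma mult_proportional_square:
  assumes d: "d \<in> selfadjoint_part D"
  shows "mult_proportional (d * d)"
proof (cases "d = 0")
  case True
  with mult_proportional_adj_mult[of 0] show ?thesis by (simp add: D_zero)
next
  case False
  define c where "c = (1 / norm d) *\<^sub>R d"
  have c: "c \<in> selfadjoint_part D" unfolding c_def by (intro sa_intros d)
  have "norm c \<le> 1" using False by (simp add: c_def)
  then have "mult_proportional (c * c)"
    using mult_proportional_adj_mult[OF sa_in[OF c]] by (simp add: sa_adj[OF c])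
  moreover have "d * d = (norm d * norm d) *\<^sub>R (c * c)"
    using False by (simp add: c_def)
  then have "d * d = complex_of_real (norm d * norm d) *\<^sub>C (c * c)"
    by (simp only: scaleR_scaleC)
  ultimately show ?thesis
    by (simp add: mult_proportional_scaleC D_mult sa_in[OF c])
qed

lemma polarization_sa:
  assumes u: "u \<in> selfadjoint_part D" and z: "z \<in> selfadjoint_part D"
  shows "u * z = (1/4) *\<^sub>C ((u + z) * (u + z)) + (-1/4) *\<^sub>C ((u - z) * (u - z))"
proof -
  have "(u + z) * (u + z) - (u - z) * (u - z) = 4 *\<^sub>R (u * z)"
    using D_comm[OF sa_in[OF u] sa_in[OF z]]
    by (simp add: algebra_simps) (simp flip: scaleR_add_left scaleR_2 add.assoc)
  then have "u * z = (1/4) *\<^sub>R ((u + z) * (u + z) - (u - z) * (u - z))"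
    by simp
  then show ?thesis
    by (simp add: scaleR_scaleC scaleC_diff_right scaleC_minus_left)
qed

text \<open>
  A product \<open>u z\<close> of selfadjoint elements is a combination of squares, and \<open>z\<close> is the limit of
  \<open>u z\<close> along local units \<open>u\<close> for \<open>z\<close>.
\<close>
lemma mult_proportional_sa:
  assumes z: "z \<in> selfadjoint_part D"
  shows "mult_proportional z"
  unfolding mult_proportional_def
proof (intro ballI)
  fix x y assume xy: "x \<in> D" "y \<in> D"
  let ?\<Delta> = "\<sigma> (z * x) * \<sigma> y - \<sigma> (z * y) * \<sigma> x"
  have "cmod ?\<Delta> \<le> e" if e: "e > 0" for e
  proof -
    define K where "K = 2 * norm x * norm y + 1"
    have K: "K > 0" by (simp add: K_def add_nonneg_pos)
    obtain u f where u: "u \<in> selfadjoint_part D" and nu: "norm (z - u * z) \<le> e / K"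
      using local_unit[OF z, of "e / K"] e K by auto
    define r where "r = z - u * z"
    have r: "r \<in> D" unfolding r_def by (intro sa_in sa_intros z u)
    have "mult_proportional (u * z)"
      unfolding polarization_sa[OF u z]
      by (intro mult_proportional_add mult_proportional_scaleC mult_proportional_square
          D_intros sa_intros u z sa_in)
    then have "\<sigma> (u * z * x) * \<sigma> y = \<sigma> (u * z * y) * \<sigma> x"
      using xy by (simp add: mult_proportional_def)
    moreover have "\<sigma> (z * w) = \<sigma> (u * z * w) + \<sigma> (r * w)" if "w \<in> D" for w
      using \<sigma>_diff[of "z * w" "u * z * w"] that
      by (simp add: r_def algebra_simps D_mult sa_in u z)
    ultimately have "?\<Delta> = \<sigma> (r * x) * \<sigma> y - \<sigma> (r * y) * \<sigma> x"
      using xy by (simp add: algebra_simps)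
    also have "cmod \<dots> \<le> norm r * norm x * norm y + norm r * norm y * norm x"
      by (intro order_trans[OF norm_triangle_ineq4] add_mono)
         (auto simp: norm_mult intro!: mult_mono \<sigma>_bound xy r D_intros
            order_trans[OF \<sigma>_bound norm_mult_ineq])
    also have "\<dots> = norm r * (2 * norm x * norm y)"
      by simp
    also have "\<dots> \<le> (e / K) * K"
      using nu e K unfolding r_def[symmetric] by (intro mult_mono) (auto simp: K_def)
    finally show ?thesis using K by simp
  qed
  then have "cmod ?\<Delta> \<le> 0" by (rule field_le_epsilon) simp
  then show "\<sigma> (z * x) * \<sigma> y = \<sigma> (z * y) * \<sigma> x" by simp
qed

lemma mult_proportional_D:
  assumes "z \<in> D" shows "mult_proportional z"
proof -
  obtain p q where pq: "p \<in> selfadjoint_part D" "q \<in> selfadjoint_part D" "z = p + \<i> *\<^sub>C q"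
    using sa_decomposition[OF assms] .
  show ?thesis
    unfolding pq(3)
    by (intro mult_proportional_add mult_proportional_scaleC mult_proportional_sa D_scaleC sa_in pq)
qed

text \<open>
  Positivity makes \<open>\<sigma>\<close> real on squares, hence on the products \<open>u z\<close>, hence on their limit \<open>z\<close>.
\<close>
lemma \<sigma>_real_sa:
  assumes z: "z \<in> selfadjoint_part D"
  shows "Im (\<sigma> z) = 0"
proof -
  have "\<bar>Im (\<sigma> z)\<bar> \<le> e" if e: "e > 0" for e
  proof -
    obtain u where u: "u \<in> selfadjoint_part D" and nu: "norm (z - u * z) \<le> e"
      using local_unit[OF z e] by metis
    have sq: "Im (\<sigma> (w * w)) = 0" if "w \<in> selfadjoint_part D" for w
      using \<sigma>_pos[OF sa_in[OF that]] by (simp add: sa_adj[OF that] less_eq_complex_def)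
    have "\<sigma> (u * z) = (1/4) * \<sigma> ((u + z) * (u + z)) + (-1/4) * \<sigma> ((u - z) * (u - z))"
      unfolding polarization_sa[OF u z]
      by (subst \<sigma>_add, (intro D_intros sa_in u z)+)
         (simp add: \<sigma>_scaleC D_intros sa_in u z)
    then have "Im (\<sigma> (u * z)) = 0"
      using sq[of "u + z"] sq[of "u - z"] by (simp add: sa_intros u z)
    then have "Im (\<sigma> z) = Im (\<sigma> (z - u * z))"
      by (simp add: \<sigma>_diff sa_in sa_mult z u)
    also have "\<bar>\<dots>\<bar> \<le> norm (z - u * z)"
      by (intro order_trans[OF abs_Im_le_cmod] \<sigma>_bound sa_in sa_intros z u)
    finally show ?thesis using nu by simp
  qed
  then have "\<bar>Im (\<sigma> z)\<bar> \<le> 0" by (rule field_le_epsilon) simp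
  then show ?thesis by simp
qed

lemma ex_sa_nonzero:
  obtains y where "y \<in> selfadjoint_part D" "\<sigma> y \<noteq> 0"
proof (rule ccontr)
  assume "\<not> thesis"
  with that have zero: "\<And>y. y \<in> selfadjoint_part D \<Longrightarrow> \<sigma> y = 0"
    by blast
  obtain x where x: "x \<in> D" "0 < cmod (\<sigma> x)"
    using \<sigma>_norming[of 0] by auto
  obtain p q where "p \<in> selfadjoint_part D" "q \<in> selfadjoint_part D" "x = p + \<i> *\<^sub>C q"
    using sa_decomposition[OF x(1)] .
  with x(2) show False
    by (simp add: \<sigma>_add \<sigma>_scaleC zero sa_in D_intros)
qed

text \<open>
  Proportionality gives \<open>\<sigma>(z x) = k \<sigma>(z) \<sigma>(x)\<close> with a constant \<open>k \<ge> 0\<close>, and the normalization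
  of \<open>\<sigma>\<close> gives \<open>k = 1\<close>: if \<open>z\<close> is a contraction that almost attains the norm of \<open>\<sigma>\<close>, then
  \<open>k |\<sigma>(z)|\<^sup>2 = |\<sigma>(z\<^sup>2)| \<le> 1\<close> yields \<open>k \<le> 1\<close>. Conversely, for local units \<open>u\<close> of an element
  \<open>y\<close> with \<open>\<sigma>(y) \<noteq> 0\<close>, the convergence of \<open>\<sigma>(u y) = k \<sigma>(u) \<sigma>(y)\<close> to \<open>\<sigma>(y)\<close> shows that
  \<open>k \<sigma>(u)\<close> tends to \<open>1\<close>, while \<open>|\<sigma>(u)| \<le> 1\<close>.
\<close>
lemma \<sigma>_mult:
  assumes "z \<in> D" "x \<in> D"
  shows "\<sigma> (z * x) = \<sigma> z * \<sigma> x"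
proof -
  obtain y where y: "y \<in> selfadjoint_part D" and y0: "\<sigma> y \<noteq> 0"
    using ex_sa_nonzero .
  have yD: "y \<in> D" using y by (rule sa_in)
  define s where "s = Re (\<sigma> y)"
  have s: "\<sigma> y = complex_of_real s" "s \<noteq> 0"
    using \<sigma>_real_sa[OF y] y0 by (auto simp: s_def complex_eq_iff)
  define k where "k = Re (\<sigma> (y * y)) / s\<^sup>2"
  have "0 \<le> \<sigma> (y * y)" using \<sigma>_pos[OF yD] by (simp add: sa_adj[OF y])
  then have k: "k \<ge> 0" "\<sigma> (y * y) = complex_of_real (k * s\<^sup>2)"
    using s(2) by (auto simp: k_def less_eq_complex_def complex_eq_iff)
  have mult: "\<sigma> (z * x) = complex_of_real k * (\<sigma> z * \<sigma> x)" if zx: "z \<in> D" "x \<in> D" for z x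
  proof -
    have "\<sigma> (z * x) * \<sigma> y = \<sigma> (z * y) * \<sigma> x"
      using mult_proportional_D[OF zx(1)] zx yD by (simp add: mult_proportional_def)
    moreover have "\<sigma> (y * z) * \<sigma> y = \<sigma> (y * y) * \<sigma> z"
      using mult_proportional_D[OF yD] zx yD by (simp add: mult_proportional_def)
    ultimately have "\<sigma> (z * x) * (\<sigma> y * \<sigma> y) = \<sigma> (y * y) * \<sigma> z * \<sigma> x"
      using D_comm[OF yD zx(1)] by (metis mult.assoc mult.commute)
    then show ?thesis
      using s(2) unfolding k(2) s(1) by (simp add: field_simps power2_eq_square)
  qed
  have "k \<le> 1"
  proof (rule ccontr)
    assume "\<not> k \<le> 1"
    then have k1: "k > 1" by simp
    obtain z where z: "z \<in> D" "norm z \<le> 1" "1 / sqrt k < cmod (\<sigma> z)"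
      using \<sigma>_norming[of "1 / sqrt k"] k1 by auto
    have "1 / k = (1 / sqrt k)\<^sup>2" using k1 by (simp add: power_divide)
    also have "\<dots> < (cmod (\<sigma> z))\<^sup>2"
      using z(3) k1 by (intro power_strict_mono) auto
    finally have "1 < k * (cmod (\<sigma> z))\<^sup>2" using k1 by (simp add: field_simps)
    also have "\<dots> = cmod (\<sigma> (z * z))"
      using k(1) by (simp add: mult z norm_mult power2_eq_square)
    also have "\<dots> \<le> norm (z * z)" by (intro \<sigma>_bound D_intros z)
    also have "\<dots> \<le> 1"
      using norm_mult_ineq[of z z] mult_mono[OF z(2) z(2)] by simp
    finally show False by simp
  qed
  moreover have "1 \<le> k"
  proof (rule field_le_epsilon)
    fix e :: real assume e: "e > 0"
    obtain u where u: "u \<in> selfadjoint_part D" "norm u \<le> 1" "norm (y - u * y) \<le> e * \<bar>s\<bar>"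
      using local_unit[OF y, of "e * \<bar>s\<bar>"] e s(2) by auto
    have uD: "u \<in> D" using u(1) by (rule sa_in)
    have "\<sigma> (y - u * y) = complex_of_real s * (1 - k * \<sigma> u)"
      by (simp add: \<sigma>_diff yD uD D_mult mult s(1) algebra_simps)
    then have "\<bar>s\<bar> * cmod (1 - k * \<sigma> u) = cmod (\<sigma> (y - u * y))"
      by (simp add: norm_mult)
    also have "\<dots> \<le> e * \<bar>s\<bar>"
      by (intro order_trans[OF \<sigma>_bound u(3)] D_intros yD uD)
    finally have "cmod (1 - k * \<sigma> u) \<le> e"
      using s(2) by (simp add: mult.commute)
    moreover have "cmod (k * \<sigma> u) \<le> k"
      using k(1) \<sigma>_bound[OF uD] u(2) by (simp add: norm_mult mult_left_le)
    ultimately show "1 \<le> k + e"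
      using norm_triangle_ineq[of "1 - k * \<sigma> u" "k * \<sigma> u"] by simp
  qed
  ultimately show ?thesis using mult[OF assms] by simp
qed

lemma ex_sa_one:
  obtains y where "y \<in> selfadjoint_part D" "\<sigma> y = 1"
proof -
  obtain y where y: "y \<in> selfadjoint_part D" and y0: "\<sigma> y \<noteq> 0"
    using ex_sa_nonzero .
  have "\<sigma> ((1 / Re (\<sigma> y)) *\<^sub>R y) = 1"
    using \<sigma>_real_sa[OF y] y0 by (simp add: \<sigma>_scaleR sa_in[OF y] complex_eq_iff power2_eq_square Re_divide Im_divide)
  then show ?thesis using that sa_scaleR[OF y] by blast
qed

text \<open>
  A local unit \<open>d\<close> for an element \<open>y\<close> with \<open>\<sigma>(y) = 1\<close> works, as \<open>1 - \<sigma>(d) = \<sigma>(y - d y)\<close>.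
\<close>
lemma norming_contraction:
  assumes e: "e > 0"
  obtains d where "d \<in> selfadjoint_part D" "norm d \<le> 1" "cmod (1 - \<sigma> d) \<le> e"
proof -
  obtain y where y: "y \<in> selfadjoint_part D" "\<sigma> y = 1"
    using ex_sa_one .
  obtain d where d: "d \<in> selfadjoint_part D" "norm d \<le> 1" "norm (y - d * y) \<le> e"
    using local_unit[OF y(1) e] by metis
  have "1 - \<sigma> d = \<sigma> (y - d * y)"
    using y d(1) by (simp add: \<sigma>_diff \<sigma>_mult sa_in D_mult)
  also have "cmod \<dots> \<le> e"
    using y d by (intro order_trans[OF \<sigma>_bound d(3)] D_intros sa_in)
  finally show ?thesis using that d by blast
qed

section \<open>States extending a pure state\<close>

text \<open>
  The difference \<open>k\<^sub>0 = a - a e\<^sub>0\<close> is annihilated by \<open>\<phi>\<close> because a norm-one functional that almost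
  attains its norm at a contraction \<open>d\<close> is small on elements \<open>k\<close> of bounded norm with \<open>d k\<close> small.
  To quantify this, put \<open>W = d + c k\<close> with \<open>|c| = \<eta>\<close>. All terms of \<open>W* W\<close> except \<open>d\<^sup>2\<close> and
  \<open>|c|\<^sup>2 k* k\<close> contain \<open>d k\<close> or its adjoint. The bound \<open>2 \<parallel>k\<^sub>0\<parallel>\<close> on the norm of \<open>k\<close> is uniform in \<open>d\<close>,
  so the error \<open>e\<close> can be sent to \<open>0\<close> with \<open>\<eta>\<close> fixed, and only then \<open>\<eta>\<close> to \<open>0\<close>.
\<close>
lemma extension_determined:
  assumes \<phi>: "state_on UNIV \<phi>" and ext: "\<And>x. x \<in> D \<Longrightarrow> \<phi> x = \<sigma> x"
    and a: "\<And>g. g \<in> D \<Longrightarrow> g * a \<in> D" and e0: "e0 \<in> D" "\<sigma> e0 = 1" and ae0: "a * e0 \<in> D"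
  shows "\<phi> a = \<sigma> (a * e0)"
proof -
  have \<phi>_add: "\<phi> (x + y) = \<phi> x + \<phi> y" and \<phi>_scaleC: "\<phi> (c *\<^sub>C x) = c * \<phi> x" for x y c
    using \<phi> by (auto simp: state_on_def positive_functional_on_def)
  have \<phi>_diff: "\<phi> (x - y) = \<phi> x - \<phi> y" for x y
    using \<phi>_add[of "x - y" y] by simp
  have \<phi>_bound: "cmod (\<phi> x) \<le> norm x" for x
    by (rule norm_bound_state[OF \<phi>]) auto
  define k0 where "k0 = a - a * e0"
  define K where "K = norm k0"
  define X where "X = cmod (\<phi> k0)"
  \<comment> \<open>The phase \<open>\<omega>\<close> makes the first-order term of \<open>\<phi> W\<close> nonnegative.\<close>
  obtain \<omega> where \<omega>: "cmod \<omega> = 1" "\<omega> * \<phi> k0 = complex_of_real X"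
  proof (cases "\<phi> k0 = 0")
    case True
    with that[of 1] show ?thesis by (simp add: X_def)
  next
    case False
    with that[of "complex_of_real X / \<phi> k0"] show ?thesis by (simp add: X_def norm_divide)
  qed
  have est: "(1 + \<eta> * X) \<le> sqrt (1 + 2 * \<eta> * e * K + 4 * \<eta>\<^sup>2 * K\<^sup>2) + e"
    if \<eta>: "\<eta> > 0" and e: "e > 0" for \<eta> e :: real
  proof -
    obtain d where d: "d \<in> selfadjoint_part D" and nd: "norm d \<le> 1" and sd: "cmod (1 - \<sigma> d) \<le> e"
      using norming_contraction[OF e] .
    obtain u where u: "u \<in> selfadjoint_part D" and nu: "norm u \<le> 1" and du: "norm (d - u * d) \<le> e"
      using local_unit[OF d e] by metis
    have dD: "d \<in> D" and uD: "u \<in> D" using d u by (auto intro: sa_in)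
    define k where "k = k0 - u * k0"
    \<comment> \<open>\<open>u k\<^sub>0 = g - g e\<^sub>0\<close> with \<open>g = u a\<close> in \<open>D\<close>, so \<open>\<sigma>\<close> vanishes on it and \<open>\<phi> k = \<phi> k\<^sub>0\<close>.\<close>
    have uk: "u * k0 = u * a - (u * a) * e0" by (simp add: k0_def algebra_simps)
    have "\<sigma> (u * k0) = 0"
      unfolding uk by (simp add: \<sigma>_diff \<sigma>_mult a uD e0 D_mult)
    moreover have "u * k0 \<in> D" unfolding uk by (intro D_intros a uD e0)
    ultimately have \<phi>k: "\<phi> k = \<phi> k0"
      by (simp add: k_def \<phi>_diff ext)
    have "norm (u * k0) \<le> K"
      using norm_mult_ineq[of u k0] mult_right_mono[OF nu, of K] by (simp add: K_def)
    then have nk: "norm k \<le> 2 * K"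
      using norm_triangle_ineq4[of k0 "u * k0"] by (simp add: k_def K_def)
    have "d * k = (d - u * d) * k0"
      using D_comm[OF dD uD] by (simp add: k_def algebra_simps flip: mult.assoc)
    then have ndk: "norm (d * k) \<le> e * K"
      using norm_mult_ineq[of "d - u * d" k0] mult_right_mono[OF du, of K] by (simp add: K_def)
    define c where "c = complex_of_real \<eta> * \<omega>"
    have nc: "cmod c = \<eta>" using \<eta> \<omega> by (simp add: c_def norm_mult)
    define W where "W = d + c *\<^sub>C k"
    have "W\<^sup>\<star> * W = d * d + (c *\<^sub>C (d * k) + (c *\<^sub>C (d * k))\<^sup>\<star>) + (c *\<^sub>C k)\<^sup>\<star> * (c *\<^sub>C k)"
      by (simp add: W_def adj_add adj_scaleC adj_mult sa_adj[OF d] algebra_simps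
          scaleC_add_right mult_scaleC_left mult_scaleC_right)
    then have "(norm W)\<^sup>2 =
        norm (d * d + (c *\<^sub>C (d * k) + (c *\<^sub>C (d * k))\<^sup>\<star>) + (c *\<^sub>C k)\<^sup>\<star> * (c *\<^sub>C k))"
      by (metis norm_adj_mult)
    also have "\<dots> \<le> 1 + (\<eta> * (e * K) + \<eta> * (e * K)) + (\<eta> * (2 * K))\<^sup>2"
    proof (intro norm_triangle_le add_mono)
      show "norm (d * d) \<le> 1"
        using norm_mult_ineq[of d d] mult_mono[OF nd nd] by simp
      show "norm (c *\<^sub>C (d * k)) \<le> \<eta> * (e * K)" "norm ((c *\<^sub>C (d * k))\<^sup>\<star>) \<le> \<eta> * (e * K)"
        using ndk \<eta> by (simp_all add: norm_adj norm_scaleC nc)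
      show "norm ((c *\<^sub>C k)\<^sup>\<star> * (c *\<^sub>C k)) \<le> (\<eta> * (2 * K))\<^sup>2"
        unfolding norm_adj_mult using nk \<eta> by (intro power_mono) (simp_all add: norm_scaleC nc)
    qed
    finally have "norm W \<le> sqrt (1 + 2 * \<eta> * e * K + 4 * \<eta>\<^sup>2 * K\<^sup>2)"
      by (intro real_le_rsqrt) (simp add: algebra_simps power_mult_distrib)
    moreover have "\<phi> W = complex_of_real (1 + \<eta> * X) - (1 - \<sigma> d)"
      using \<omega>(2) by (simp add: W_def \<phi>_add \<phi>_scaleC ext dD \<phi>k c_def mult.assoc)
    then have "cmod (complex_of_real (1 + \<eta> * X)) \<le> cmod (\<phi> W) + cmod (1 - \<sigma> d)"
      by (metis diff_add_cancel norm_triangle_ineq)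
    then have "1 + \<eta> * X \<le> cmod (\<phi> W) + cmod (1 - \<sigma> d)"
      using \<eta> unfolding norm_of_real X_def by simp
    ultimately show ?thesis
      using \<phi>_bound[of W] sd by linarith
  qed
  have lim: "1 + \<eta> * X \<le> sqrt (1 + 4 * \<eta>\<^sup>2 * K\<^sup>2)" if \<eta>: "\<eta> > 0" for \<eta> :: real
  proof (rule tendsto_lowerbound)
    have "((\<lambda>e. sqrt (1 + 2 * \<eta> * e * K + 4 * \<eta>\<^sup>2 * K\<^sup>2) + e) \<longlongrightarrow>
        sqrt (1 + 2 * \<eta> * 0 * K + 4 * \<eta>\<^sup>2 * K\<^sup>2) + 0) (at_right 0)"
      by (intro tendsto_intros)
    then show "((\<lambda>e. sqrt (1 + 2 * \<eta> * e * K + 4 * \<eta>\<^sup>2 * K\<^sup>2) + e) \<longlongrightarrow>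
        sqrt (1 + 4 * \<eta>\<^sup>2 * K\<^sup>2)) (at_right 0)" by simp
    show "\<forall>\<^sub>F e in at_right 0. 1 + \<eta> * X \<le> sqrt (1 + 2 * \<eta> * e * K + 4 * \<eta>\<^sup>2 * K\<^sup>2) + e"
      using eventually_at_right_less[of 0] by eventually_elim (rule est[OF \<eta>])
  qed simp
  have "X \<le> 0 + \<eta>'" if "\<eta>' > 0" for \<eta>' :: real
  proof -
    \<comment> \<open>Squaring \<open>lim\<close> gives \<open>X \<le> 2 \<eta> K\<^sup>2\<close>; the summand \<open>1\<close> covers the case \<open>K = 0\<close>.\<close>
    define \<eta> where "\<eta> = \<eta>' / (2 * K\<^sup>2 + 1)"
    have \<eta>: "\<eta> > 0" using that by (simp add: \<eta>_def add_nonneg_pos)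
    have "(1 + \<eta> * X)\<^sup>2 \<le> 1 + 4 * \<eta>\<^sup>2 * K\<^sup>2"
      using lim[OF \<eta>] \<eta> by (intro sqrt_ge_absD) (simp add: X_def)
    then have "\<eta> * (2 * X) \<le> \<eta> * (4 * \<eta> * K\<^sup>2)"
      using zero_le_power2[of "\<eta> * X"] by (simp add: power2_eq_square algebra_simps)
    then have "X \<le> \<eta> * (2 * K\<^sup>2)" using \<eta> by simp
    also have "\<dots> \<le> \<eta> * (2 * K\<^sup>2 + 1)" using \<eta> by simp
    also have "\<dots> = \<eta>'" by (simp add: \<eta>_def) (smt (verit) zero_le_power2)
    finally show ?thesis by simp
  qed
  then have "X \<le> 0" by (rule field_le_epsilon)
  then have "\<phi> k0 = 0" by (simp add: X_def)
  then show ?thesis by (simp add: k0_def \<phi>_diff ext ae0)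
qed

end

lemma states_agree_on_normalizer:
  assumes n: "n \<in> normalizers D" and st: "state_on UNIV \<rho>\<^sub>1" "state_on UNIV \<rho>\<^sub>2"
    and eq: "restrict \<rho>\<^sub>1 D = restrict \<rho>\<^sub>2 D" and pure: "pure_state_on D (restrict \<rho>\<^sub>1 D)"
  shows "\<rho>\<^sub>1 (n\<^sup>\<star> * n) = \<rho>\<^sub>2 (n\<^sup>\<star> * n)"
proof -
  obtain e0 where e0: "e0 \<in> selfadjoint_part D" "restrict \<rho>\<^sub>1 D e0 = 1"
    using ex_sa_one[OF pure] .
  have "\<rho> (n\<^sup>\<star> * n) = restrict \<rho>\<^sub>1 D (n\<^sup>\<star> * n * e0)"
    if "state_on UNIV \<rho>" "restrict \<rho> D = restrict \<rho>\<^sub>1 D" for \<rho>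
    using e0
    by (intro extension_determined[OF pure that(1)])
       (auto intro: sa_in normalizer_commute normalizer_one_sided n simp flip: that(2))
  from this[OF st(1)] this[OF st(2)] show ?thesis using eq by simp
qed

end

theorem proposition2p1:
  fixes D :: "'a::cstar_algebra set"
  assumes "inclusion D"
  shows "(\<forall>n\<in>normalizers D. \<forall>d\<in>D.
            n\<^sup>\<star> * n * d = d * n\<^sup>\<star> * n \<and> d * n\<^sup>\<star> * n \<in> D \<and>
            n * n\<^sup>\<star> * d = d * n * n\<^sup>\<star> \<and> d * n * n\<^sup>\<star> \<in> D) \<and>
         (\<forall>n\<in>normalizers D. \<forall>\<rho>\<^sub>1 \<rho>\<^sub>2.
            state_on UNIV \<rho>\<^sub>1 \<and> state_on UNIV \<rho>\<^sub>2 \<and>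
            restrict \<rho>\<^sub>1 D = restrict \<rho>\<^sub>2 D \<and> restrict \<rho>\<^sub>1 D \<in> pure_states D \<longrightarrow>
            \<rho>\<^sub>1 (n\<^sup>\<star> * n) = \<rho>\<^sub>2 (n\<^sup>\<star> * n) \<and> \<rho>\<^sub>1 (n * n\<^sup>\<star>) = \<rho>\<^sub>2 (n * n\<^sup>\<star>))"
proof (intro conjI ballI allI impI)
  fix n d assume n: "n \<in> normalizers D" and d: "d \<in> D"
  note comm = normalizer_commute[OF assms n d]
    normalizer_commute[OF assms adj_normalizer[OF n] d]
  show "n\<^sup>\<star> * n * d = d * n\<^sup>\<star> * n" "d * n\<^sup>\<star> * n \<in> D"
    "n * n\<^sup>\<star> * d = d * n * n\<^sup>\<star>" "d * n * n\<^sup>\<star> \<in> D"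
    using comm by (simp_all add: adj_adj mult.assoc)
next
  fix n \<rho>\<^sub>1 \<rho>\<^sub>2
  assume n: "n \<in> normalizers D"
    and "state_on UNIV \<rho>\<^sub>1 \<and> state_on UNIV \<rho>\<^sub>2 \<and>
      restrict \<rho>\<^sub>1 D = restrict \<rho>\<^sub>2 D \<and> restrict \<rho>\<^sub>1 D \<in> pure_states D"
  then have \<rho>: "state_on UNIV \<rho>\<^sub>1" "state_on UNIV \<rho>\<^sub>2" "restrict \<rho>\<^sub>1 D = restrict \<rho>\<^sub>2 D"
      "pure_state_on D (restrict \<rho>\<^sub>1 D)"
    by (auto simp: pure_states_def)
  show "\<rho>\<^sub>1 (n\<^sup>\<star> * n) = \<rho>\<^sub>2 (n\<^sup>\<star> * n)"
    by (rule states_agree_on_normalizer[OF assms n \<rho>])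
  show "\<rho>\<^sub>1 (n * n\<^sup>\<star>) = \<rho>\<^sub>2 (n * n\<^sup>\<star>)"
    using states_agree_on_normalizer[OF assms adj_normalizer[OF n] \<rho>] by (simp add: adj_adj)
qed

end
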